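(* Suppose that $W\subset\mathbb{R}^n$ is compact, that $\ell:\mathbb{R}^n\times Z\to\mathbb{R}$ is a locally sup-integrable Caratheodory function relative to the probability space $(Z,\mathcal{Z},\mathbb{P})$, and that for every $w\in W$ the moment generating function of the random variable $\ell(w,\cdot)-R(w)$ is real-valued in a neighborhood of zero. Then, for any $\varepsilon>0$ and $\gamma>0$, there exist constants $\eta>0$ and $\beta>0$, independent of $m$, such that for every $m\in\{1,2,\dots\}$ $$\mathbb{P}^m\Big(\sup_{w\in W}\big\{R(w)-R_m^\gamma(w)\big\}\leq\varepsilon\Big)\geq 1-\eta e^{-\beta m}.$$
   Context: Let $(Z,\mathcal{Z},\mathbb{P})$ be a probability space with $Z\subset\mathbb{R}^d$, and let $(Z^m,\mathcal{Z}^m,\mathbb{P}^m)$ be the $m$-fold product probability space, so that the data $(z_1,\dots,z_m)\in Z^m$ is obtained by independent sampling according to $\mathbb{P}$. Let $\|\cdot\|$ be any fixed norm on $\mathbb{R}^n$. $\mathbb{E}$ denotes expectation with respect to $\mathbb{P}$. A function $f:\mathbb{R}^n\times Z\to\mathbb{R}$ is a Caratheodory function relative to $(Z,\mathcal{Z},\mathbb{P})$ if $f(\cdot,z)$ is continuous for every $z\in Z$ and $f(w,\cdot)$ is $\mathcal{Z}$-measurable for every $w\in\mathbb{R}^n$. A Caratheodory function $\ell:\mathbb{R}^n\times Z\to\mathbb{R}$ is locally sup-integrable if for every $\bar w\in\mathbb{R}^n$ there exists $\rho>0$ such that $\int\max\{0,\sup\{\ell(w,z)\mid\|w-\bar w\|\leq\rho\}\}\,d\mathbb{P}(z)<\infty$.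 The true risk is $R(w)=\mathbb{E}[\ell(w,z)]=\int\ell(w,z)\,d\mathbb{P}(z)$. The empirical risk is $R_m(w)=\frac1m\sum_{i=1}^m\ell(w,z_i)$. For $\gamma\geq 0$, the diametrical risk is $R_m^\gamma(w)=\sup_{\|v\|\leq\gamma}R_m(w+v)$. Both $R_m$ and $R_m^\gamma$ are viewed as functions of $w$ and of the random data $(z_1,\dots,z_m)$. The moment generating function of a random variable $X$ is $\tau\mapsto E[\exp(\tau X)]$, $\tau\in\mathbb{R}$. *)

theory Defs
  imports "HOL-Probability.Probability"
begin

text \<open>An arbitrary norm on a real vector space, not necessarily the one of the type class.\<close>

definition is_norm :: "('a::real_vector \<Rightarrow> real) \<Rightarrow> bool" where
  "is_norm N \<longleftrightarrow>
     (\<forall>x. 0 \<le> N x) \<and>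
     (\<forall>x. N x = 0 \<longleftrightarrow> x = 0) \<and>
     (\<forall>c x. N (c *\<^sub>R x) = \<bar>c\<bar> * N x) \<and>
     (\<forall>x y. N (x + y) \<le> N x + N y)"

definition caratheodory :: "'z measure \<Rightarrow> ('w::topological_space \<Rightarrow> 'z \<Rightarrow> real) \<Rightarrow> bool" where
  "caratheodory M f \<longleftrightarrow>
     (\<forall>z\<in>space M. continuous_on UNIV (\<lambda>w. f w z)) \<and>
     (\<forall>w. f w \<in> borel_measurable M)"

definition locally_sup_integrable ::
    "('w::real_vector \<Rightarrow> real) \<Rightarrow> 'z measure \<Rightarrow> ('w \<Rightarrow> 'z \<Rightarrow> real) \<Rightarrow> bool" where
  "locally_sup_integrable N M l \<longleftrightarrow>
     (\<forall>w0. \<exists>\<rho>>0.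
        (\<integral>\<^sup>+ z. e2ennreal (max 0 (SUP w\<in>{w. N (w - w0) \<le> \<rho>}. ereal (l w z))) \<partial>M) < \<infinity>)"

text \<open>The Bochner integral is \<open>0\<close> when \<open>l w\<close> is not integrable. This value plays no role at points
  where the moment generating function of \<open>l w - true_risk M l w\<close> is finite near zero, since there
  \<open>l w\<close> is integrable.\<close>

definition true_risk :: "'z measure \<Rightarrow> ('w \<Rightarrow> 'z \<Rightarrow> real) \<Rightarrow> 'w \<Rightarrow> real" where
  "true_risk M l w = (\<integral>z. l w z \<partial>M)"

definition empirical_risk :: "('w \<Rightarrow> 'z \<Rightarrow> real) \<Rightarrow> nat \<Rightarrow> (nat \<Rightarrow> 'z) \<Rightarrow> 'w \<Rightarrow> real" where
  "empirical_risk l m zs w = (1 / real m) * (\<Sum>i=1..m. l w (zs i))"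

definition diametrical_risk ::
    "('w::real_vector \<Rightarrow> real) \<Rightarrow> ('w \<Rightarrow> 'z \<Rightarrow> real) \<Rightarrow> real \<Rightarrow> nat \<Rightarrow> (nat \<Rightarrow> 'z) \<Rightarrow> 'w \<Rightarrow> ereal" where
  "diametrical_risk N l \<gamma> m zs w = (SUP v\<in>{v. N v \<le> \<gamma>}. ereal (empirical_risk l m zs (w + v)))"

text \<open>The moment generating function takes values in \<open>[0, \<infinity>]\<close>; it is real-valued at \<open>\<tau>\<close> iff it is
  smaller than \<open>\<infinity>\<close> there.\<close>

definition mgf :: "'z measure \<Rightarrow> ('z \<Rightarrow> real) \<Rightarrow> real \<Rightarrow> ennreal" where
  "mgf M X \<tau> = (\<integral>\<^sup>+ z. ennreal (exp (\<tau> * X z)) \<partial>M)"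

end

theory Submission
  imports Defs
begin

text \<open>
  The diametrical risk at \<open>w\<close> dominates the empirical risk at every point within distance \<open>\<gamma>\<close> of \<open>w\<close>.
  A bound at one centre \<open>c\<close> therefore serves a whole neighbourhood of \<open>c\<close>, which reduces the
  uniform estimate to finitely many pointwise ones. By Fatou's lemma, applied with the integrable local majorant,
  the true risk \<open>R\<close> is upper semicontinuous on \<open>W\<close>, so each centre \<open>c \<in> W\<close> has a neighbourhood
  on which \<open>R w < R c + \<epsilon> / 2\<close> and \<open>N (c - w) \<le> \<gamma>\<close>. Compactness selects finitely many centres
  (\<open>finite_cover_of_risk\<close>). If the empirical risk exceeds \<open>R c - \<epsilon> / 2\<close> at all of them, then for
  every \<open>w \<in> W\<close>, with \<open>c\<close> a centre of a neighbourhood that contains \<open>w\<close>, the diametrical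
  risk at \<open>w\<close> is at least the empirical risk at \<open>c\<close>, which is more than
  \<open>R c - \<epsilon> / 2 > R w - \<epsilon>\<close>.

  The probability that a given centre violates its bound decays exponentially in the sample size
  (\<open>empirical_risk_lower_tail\<close>): a centred variable whose moment generating function is finite
  near zero satisfies \<open>E (exp (\<tau> X)) \<le> 1 + C \<tau>\<^sup>2\<close> for small \<open>\<tau>\<close>, and Chernoff's argument with a
  small negative \<open>\<tau>\<close> applies. A union bound over the centres gives \<open>\<eta>\<close> in terms of their number
  and \<open>\<beta>\<close> as the smallest of their rates.

  One point remains, since \<open>measure\<close> vanishes on sets that are not measurable: the event involves a
  supremum over the uncountable set \<open>W\<close> of a function that is merely upper semicontinuous in \<open>w\<close>,
  for which a dense subset of \<open>W\<close> is not enough. It suffices, however, to test a countable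
  \<open>D \<subseteq> W\<close> over which the graph of \<open>R\<close> is dense in the graph of \<open>R\<close> over \<open>W\<close>
  (\<open>deviation_event_measurable\<close>).
\<close>

section \<open>Norms on Euclidean space\<close>

lemma is_norm_zero: "is_norm N \<Longrightarrow> N 0 = 0"
  by (simp add: is_norm_def)

text \<open>
  A norm is a finite convex function on the whole space.
\<close>

lemma is_norm_continuous_on:
  fixes N :: "'a::euclidean_space \<Rightarrow> real"
  assumes "is_norm N"
  shows "continuous_on UNIV N"
proof (rule convex_on_continuous)
  have tri: "N (x + y) \<le> N x + N y" and hom: "N (c *\<^sub>R x) = \<bar>c\<bar> * N x" for x y c
    using assms by (auto simp: is_norm_def)
  show "convex_on UNIV N"
  proof (rule convex_onI)
    fix t :: real and x y :: 'a
    assume "0 < t" "t < 1"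
    then show "N ((1 - t) *\<^sub>R x + t *\<^sub>R y) \<le> (1 - t) * N x + t * N y"
      using tri[of "(1 - t) *\<^sub>R x" "t *\<^sub>R y"] by (simp add: hom)
  qed simp
qed simp

text \<open>
  Boundedness comes from the equivalence of norms: \<open>N\<close> attains a positive minimum on the
  Euclidean unit sphere, and by homogeneity that minimum is a constant \<open>c\<close> with
  \<open>c * norm x \<le> N x\<close>.
\<close>

lemma is_norm_compact_ball:
  fixes N :: "'a::euclidean_space \<Rightarrow> real"
  assumes "is_norm N"
  shows "compact {v. N v \<le> r}"
proof -
  have cont: "continuous_on UNIV N"
    using assms by (rule is_norm_continuous_on)
  have hom: "N (c *\<^sub>R x) = \<bar>c\<bar> * N x" and nonneg: "0 \<le> N x" and zero: "N x = 0 \<longleftrightarrow> x = 0" for c x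
    using assms by (auto simp: is_norm_def)
  obtain u where u: "u \<in> sphere (0::'a) 1" and min: "\<And>x. x \<in> sphere 0 1 \<Longrightarrow> N u \<le> N x"
    using continuous_attains_inf[of "sphere (0::'a) 1" N] continuous_on_subset[OF cont] by auto
  have "N u > 0"
    using u nonneg[of u] zero[of u] by (auto simp: less_le)
  have lower: "N u * norm x \<le> N x" for x
  proof (cases "x = 0")
    case False
    then have "N x = norm x * N ((1 / norm x) *\<^sub>R x)"
      by (simp add: hom)
    moreover have "N u \<le> N ((1 / norm x) *\<^sub>R x)"
      using False by (intro min) simp
    ultimately show ?thesis
      by (metis mult.commute mult_left_mono norm_ge_zero)
  qed (simp add: zero[THEN iffD2])
  have "norm x \<le> r / N u" if "N x \<le> r" for x
    using lower[of x] that \<open>N u > 0\<close> by (simp add: pos_le_divide_eq mult.commute)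
  then have "bounded {v. N v \<le> r}"
    by (auto simp: bounded_iff)
  moreover have "closed {v. N v \<le> r}"
    using cont by (intro closed_Collect_le) auto
  ultimately show ?thesis
    by (simp add: compact_eq_bounded_closed)
qed

section \<open>Suprema of continuous functions\<close>

lemma SUP_dense_subset:
  fixes f :: "'a::metric_space \<Rightarrow> real"
  assumes "continuous_on S f" "T \<subseteq> S" "S \<subseteq> closure T"
  shows "(SUP x\<in>S. ereal (f x)) = (SUP x\<in>T. ereal (f x))"
proof (rule antisym)
  show "(SUP x\<in>S. ereal (f x)) \<le> (SUP x\<in>T. ereal (f x))"
  proof (rule SUP_least)
    fix x assume "x \<in> S"
    then obtain y where y: "\<And>k. y k \<in> T" "y \<longlonglongrightarrow> x"
      using assms(3) by (meson closure_sequential subsetD)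
    have "(\<lambda>k. f (y k)) \<longlonglongrightarrow> f x"
      using y assms(1,2) \<open>x \<in> S\<close>
      by (auto simp: continuous_on_sequentially o_def subset_iff)
    then have "(\<lambda>k. ereal (f (y k))) \<longlonglongrightarrow> ereal (f x)"
      by simp
    then show "ereal (f x) \<le> (SUP x\<in>T. ereal (f x))"
      by (rule LIMSEQ_le_const2) (use y in \<open>auto intro!: exI[of _ 0] SUP_upper2\<close>)
  qed
  show "(SUP x\<in>T. ereal (f x)) \<le> (SUP x\<in>S. ereal (f x))"
    using assms(2) by (rule SUP_subset_mono) simp
qed

lemma borel_measurable_SUP_continuous:
  fixes f :: "'a::{metric_space, second_countable_topology} \<Rightarrow> 'z \<Rightarrow> real"
  assumes "\<And>z. z \<in> space M \<Longrightarrow> continuous_on S (\<lambda>x. f x z)"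
    and "\<And>x. x \<in> S \<Longrightarrow> f x \<in> borel_measurable M"
  shows "(\<lambda>z. SUP x\<in>S. ereal (f x z)) \<in> borel_measurable M"
proof -
  obtain T where T: "countable T" "T \<subseteq> S" "S \<subseteq> closure T"
    using separable[of S] by blast
  have "(\<lambda>z. SUP x\<in>T. ereal (f x z)) \<in> borel_measurable M"
    using T assms(2) by (intro borel_measurable_SUP) auto
  then show ?thesis
    using SUP_dense_subset[OF assms(1) T(2,3)] by (simp cong: measurable_cong)
qed

text \<open>
  A supremum over a compact set is attained. This replaces the extended-real inequality by the
  existence of a point, a form that survives limits in the outer variable.
\<close>

lemma le_SUP_compact_iff:
  fixes f :: "'a::topological_space \<Rightarrow> real"
  assumes "compact B" "B \<noteq> {}" "continuous_on B f"
  shows "ereal a - (SUP v\<in>B. ereal (f v)) \<le> ereal \<epsilon> \<longleftrightarrow> (\<exists>v\<in>B. a - \<epsilon> \<le> f v)"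
proof -
  obtain u where u: "u \<in> B" "\<And>v. v \<in> B \<Longrightarrow> f v \<le> f u"
    using continuous_attains_sup[OF assms] by blast
  have "(SUP v\<in>B. ereal (f v)) = ereal (f u)"
    using u by (intro SUP_eqI) auto
  then show ?thesis
    using u by (auto simp: algebra_simps) (meson add_left_mono order_trans)
qed

text \<open>
  Approximate \<open>(w, R w)\<close> by graph points over \<open>D\<close>. The witnesses \<open>v\<close> there accumulate in the
  compact set \<open>B\<close>, and an accumulation point is a witness at \<open>w\<close>. Density of \<open>D\<close> alone
  would not make the values of \<open>R\<close> converge; density of the graph does.
\<close>

lemma dense_graph_extends_bound:
  fixes R :: "'a::euclidean_space \<Rightarrow> real"
  assumes "compact B" "continuous_on UNIV f"
    and dense: "(\<lambda>w. (w, R w)) ` W \<subseteq> closure ((\<lambda>w. (w, R w)) ` D)"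
    and bound: "\<And>w. w \<in> D \<Longrightarrow> \<exists>v\<in>B. R w - \<epsilon> \<le> f (w + v)"
    and "w \<in> W"
  shows "\<exists>v\<in>B. R w - \<epsilon> \<le> f (w + v)"
proof -
  have "(w, R w) \<in> closure ((\<lambda>w. (w, R w)) ` D)"
    using dense \<open>w \<in> W\<close> by blast
  then obtain p where p: "\<And>k. p k \<in> (\<lambda>w. (w, R w)) ` D" "p \<longlonglongrightarrow> (w, R w)"
    unfolding closure_sequential by blast
  define x where "x k = fst (p k)" for k
  have x: "x k \<in> D" "snd (p k) = R (x k)" for k
    using p(1)[of k] by (auto simp: x_def)
  have lim_x: "x \<longlonglongrightarrow> w"
    using tendsto_fst[OF p(2)] by (simp add: x_def[abs_def])
  have lim_R: "(\<lambda>k. R (x k)) \<longlonglongrightarrow> R w"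
    using tendsto_snd[OF p(2)] x(2) by simp
  obtain v where v: "\<And>k. v k \<in> B" "\<And>k. R (x k) - \<epsilon> \<le> f (x k + v k)"
    using bound[OF x(1)] by metis
  obtain u r where u: "u \<in> B" "strict_mono (r :: nat \<Rightarrow> nat)" "(v \<circ> r) \<longlonglongrightarrow> u"
    using assms(1) v(1) unfolding compact_def by blast
  have "(\<lambda>k. x (r k) + v (r k)) \<longlonglongrightarrow> w + u"
    using LIMSEQ_subseq_LIMSEQ[OF lim_x u(2)] u(3) by (intro tendsto_add) (auto simp: o_def)
  then have "(\<lambda>k. f (x (r k) + v (r k))) \<longlonglongrightarrow> f (w + u)"
    using assms(2) by (auto simp: continuous_on_sequentially o_def)
  moreover have "(\<lambda>k. R (x (r k)) - \<epsilon>) \<longlonglongrightarrow> R w - \<epsilon>"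
    using LIMSEQ_subseq_LIMSEQ[OF lim_R u(2)] by (intro tendsto_diff) (auto simp: o_def)
  ultimately have "R w - \<epsilon> \<le> f (w + u)"
    using v(2) by (intro LIMSEQ_le) auto
  then show ?thesis
    using u(1) by blast
qed

section \<open>Measurability of the deviation event\<close>

lemma empirical_risk_measurable:
  assumes "l w \<in> borel_measurable M"
  shows "(\<lambda>zs. empirical_risk l m zs w) \<in> borel_measurable (\<Pi>\<^sub>M i\<in>{1..m}. M)"
  unfolding empirical_risk_def
  by (intro borel_measurable_times borel_measurable_const borel_measurable_sum
      measurable_compose[OF measurable_component_singleton[where M = "\<lambda>_. M"] assms])

lemma empirical_risk_continuous:
  assumes "caratheodory M l" "zs \<in> space (\<Pi>\<^sub>M i\<in>{1..m}. M)"
  shows "continuous_on UNIV (empirical_risk l m zs)"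
  unfolding empirical_risk_def using assms
  by (intro continuous_intros) (auto simp: caratheodory_def space_PiM PiE_iff)

text \<open>
  The graph of \<open>R\<close> over \<open>W\<close> is a subset of a separable metric space and so has a countable dense
  subset, the graph over some countable \<open>D\<close>. By \<open>dense_graph_extends_bound\<close> the event is decided on \<open>D\<close>. For a
  fixed \<open>w\<close> the diametrical risk is measurable because its supremum reduces to a countable one.
\<close>

lemma deviation_event_measurable:
  fixes R :: "'w::euclidean_space \<Rightarrow> real"
  assumes "is_norm N" "caratheodory M l" "0 \<le> \<gamma>"
  shows "{zs \<in> space (\<Pi>\<^sub>M i\<in>{1..m}. M).
           (SUP w\<in>W. ereal (R w) - diametrical_risk N l \<gamma> m zs w) \<le> ereal \<epsilon>}
         \<in> sets (\<Pi>\<^sub>M i\<in>{1..m}. M)"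
proof -
  define P where "P = (\<Pi>\<^sub>M i\<in>{1..m}. M)"
  define B where "B = {v. N v \<le> \<gamma>}"
  have "compact B"
    unfolding B_def using assms(1) by (rule is_norm_compact_ball)
  have "0 \<in> B"
    using assms(1,3) by (simp add: B_def is_norm_zero)
  then have "B \<noteq> {}"
    by blast
  define \<Gamma> where "\<Gamma> w = (w, R w)" for w
  obtain G where G: "countable G" "G \<subseteq> \<Gamma> ` W" "\<Gamma> ` W \<subseteq> closure G"
    using separable[of "\<Gamma> ` W"] by blast
  obtain D where D: "countable D" "D \<subseteq> W" "G = \<Gamma> ` D"
    using G(1,2) by (metis countable_subset_image)
  have cont: "continuous_on UNIV (empirical_risk l m zs)" if "zs \<in> space P" for zs
    using empirical_risk_continuous assms(2) that unfolding P_def .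
  have shift: "continuous_on B (\<lambda>v. empirical_risk l m zs (w + v))" if "zs \<in> space P" for zs w
    by (rule continuous_on_compose2[OF cont[OF that]]) (auto intro!: continuous_intros)
  have iff: "ereal (R w) - diametrical_risk N l \<gamma> m zs w \<le> ereal \<epsilon>
      \<longleftrightarrow> (\<exists>v\<in>B. R w - \<epsilon> \<le> empirical_risk l m zs (w + v))" if "zs \<in> space P" for zs w
    unfolding diametrical_risk_def B_def[symmetric]
    by (rule le_SUP_compact_iff[OF \<open>compact B\<close> \<open>B \<noteq> {}\<close> shift[OF that]])
  have "(\<forall>w\<in>W. ereal (R w) - diametrical_risk N l \<gamma> m zs w \<le> ereal \<epsilon>)
      \<longleftrightarrow> (\<forall>w\<in>D. ereal (R w) - diametrical_risk N l \<gamma> m zs w \<le> ereal \<epsilon>)"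
    if "zs \<in> space P" for zs
    unfolding iff[OF that]
    using dense_graph_extends_bound[OF \<open>compact B\<close> cont[OF that], of R W D \<epsilon>] G(3) D(2,3)
    by (auto simp: \<Gamma>_def)
  then have "{zs \<in> space P. (SUP w\<in>W. ereal (R w) - diametrical_risk N l \<gamma> m zs w) \<le> ereal \<epsilon>}
      = {zs \<in> space P. \<forall>w\<in>D. ereal (R w) - diametrical_risk N l \<gamma> m zs w \<le> ereal \<epsilon>}"
    by (auto simp: SUP_le_iff)
  also have "\<dots> \<in> sets P"
  proof -
    have meas: "(\<lambda>zs. diametrical_risk N l \<gamma> m zs w) \<in> borel_measurable P" for w
      unfolding diametrical_risk_def B_def[symmetric]
    proof (rule borel_measurable_SUP_continuous)
      show "(\<lambda>zs. empirical_risk l m zs (w + v)) \<in> borel_measurable P" for v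
        unfolding P_def using assms(2)
        by (intro empirical_risk_measurable) (auto simp: caratheodory_def)
    qed (rule shift)
    show ?thesis
      using D(1) meas by measurable
  qed
  finally show ?thesis
    by (simp add: P_def)
qed

section \<open>Upper semicontinuity of the true risk\<close>

text \<open>
  This is the reverse Fatou lemma. The local supremum bounds \<open>l w\<close> from above only, so dominated
  convergence is applied not to \<open>l w\<close> but to the maximum of \<open>l w\<close> and \<open>l w0\<close>, which is bounded from
  below by \<open>l w0\<close>, still converges pointwise to \<open>l w0\<close>, and has an integral at least \<open>R w\<close>.
  The integrability condition on \<open>w\<close> excludes the points where \<open>true_risk\<close> is the conventional
  value 0 of an integral that does not exist.
\<close>

lemma true_risk_upper_semicontinuous:
  fixes l :: "'w::euclidean_space \<Rightarrow> 'z \<Rightarrow> real"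
  assumes "is_norm N" "caratheodory M l" "locally_sup_integrable N M l"
    and int0: "integrable M (l w0)" and "e > 0"
  shows "\<forall>\<^sub>F w in nhds w0. integrable M (l w) \<longrightarrow> true_risk M l w < true_risk M l w0 + e"
proof -
  have meas: "l w \<in> borel_measurable M" for w
    using assms(2) by (auto simp: caratheodory_def)
  have cont: "continuous_on UNIV (\<lambda>w. l w z)" if "z \<in> space M" for z
    using assms(2) that by (auto simp: caratheodory_def)
  obtain \<rho> where "\<rho> > 0"
    and fin: "(\<integral>\<^sup>+ z. e2ennreal (max 0 (SUP w\<in>{w. N (w - w0) \<le> \<rho>}. ereal (l w z))) \<partial>M) < \<infinity>"
    using assms(3) by (auto simp: locally_sup_integrable_def)
  define B where "B = {w. N (w - w0) \<le> \<rho>}"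
  define h where "h z = e2ennreal (max 0 (SUP w\<in>B. ereal (l w z)))" for z
  define g where "g z = enn2real (h z)" for z
  have sup_meas: "(\<lambda>z. SUP w\<in>B. ereal (l w z)) \<in> borel_measurable M"
    by (rule borel_measurable_SUP_continuous) (auto intro: continuous_on_subset[OF cont] meas)
  then have h_meas: "h \<in> borel_measurable M"
    unfolding h_def by measurable
  have h_fin: "(\<integral>\<^sup>+ z. h z \<partial>M) < \<infinity>"
    using fin by (simp add: h_def B_def)
  then have h_AE: "AE z in M. h z \<noteq> \<infinity>"
    using h_meas by (intro nn_integral_PInf_AE) auto
  have "(\<integral>\<^sup>+ z. ennreal (g z) \<partial>M) = (\<integral>\<^sup>+ z. h z \<partial>M)"
    using h_AE by (intro nn_integral_cong_AE) (auto simp: g_def less_top)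
  moreover have "g \<in> borel_measurable M"
    unfolding g_def using h_meas by measurable
  ultimately have g_int: "integrable M g"
    using h_fin by (intro integrableI_nonneg) (auto simp: g_def)
  have upper: "AE z in M. \<forall>w\<in>B. l w z \<le> g z"
    using h_AE
  proof eventually_elim
    case (elim z)
    show ?case
    proof
      fix w assume "w \<in> B"
      then have "ereal (l w z) \<le> max 0 (SUP w\<in>B. ereal (l w z))"
        by (intro max.coboundedI2 SUP_upper)
      then have "ennreal (l w z) \<le> h z"
        unfolding h_def using e2ennreal_mono by fastforce
      then have "ennreal (l w z) \<le> ennreal (g z)"
        using elim by (simp add: g_def less_top)
      then show "l w z \<le> g z"
        by (auto simp: g_def ennreal_le_iff2 intro: order_trans[OF _ enn2real_nonneg])
    qed
  qed
  have "\<forall>\<^sub>F w in inf (nhds w0) (principal {w. integrable M (l w)}).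
      true_risk M l w < true_risk M l w0 + e"
  proof (rule sequentially_imp_eventually_nhds_within, intro allI impI, elim conjE)
    fix x :: "nat \<Rightarrow> 'w"
    assume "\<forall>k. x k \<in> {w. integrable M (l w)}" and lim: "x \<longlonglongrightarrow> w0"
    then have x_int: "integrable M (l (x k))" for k
      by auto
    have "(\<lambda>k. N (x k - w0)) \<longlonglongrightarrow> N (w0 - w0)"
      by (rule continuous_on_tendsto_compose[OF is_norm_continuous_on[OF assms(1)]
            tendsto_diff[OF lim tendsto_const]]) auto
    then have "\<forall>\<^sub>F k in sequentially. N (x k - w0) < \<rho>"
      using \<open>\<rho> > 0\<close> assms(1) by (intro order_tendstoD(2)) (auto simp: is_norm_zero)
    then obtain K where "\<And>k. k \<ge> K \<Longrightarrow> N (x k - w0) < \<rho>"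
      by (auto simp: eventually_sequentially)
    then have K: "x (k + K) \<in> B" for k
      by (simp add: B_def less_imp_le)
    define u where "u k z = max (l (x (k + K)) z) (l w0 z)" for k z
    have u_int: "integrable M (u k)" for k
      unfolding u_def using x_int int0 by (intro integrable_max) auto
    have "(\<lambda>k. \<integral>z. u k z \<partial>M) \<longlonglongrightarrow> (\<integral>z. l w0 z \<partial>M)"
    proof (rule integral_dominated_convergence[where w = "\<lambda>z. g z + \<bar>l w0 z\<bar>"])
      show "AE z in M. (\<lambda>k. u k z) \<longlonglongrightarrow> l w0 z"
      proof (rule AE_I2)
        fix z assume "z \<in> space M"
        have "(\<lambda>k. l (x (k + K)) z) \<longlonglongrightarrow> l w0 z"
          using continuous_on_tendsto_compose[OF cont[OF \<open>z \<in> space M\<close>] LIMSEQ_ignore_initial_segment[OF lim]]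
          by simp
        from tendsto_max[OF this tendsto_const[of "l w0 z"]]
        show "(\<lambda>k. u k z) \<longlonglongrightarrow> l w0 z"
          by (simp add: u_def)
      qed
      show "AE z in M. norm (u k z) \<le> g z + \<bar>l w0 z\<bar>" for k
        using upper
      proof eventually_elim
        case (elim z)
        then have "l (x (k + K)) z \<le> g z"
          using K by blast
        moreover have "0 \<le> g z"
          by (simp add: g_def)
        ultimately show ?case
          unfolding u_def real_norm_def by linarith
      qed
    qed (use meas g_int int0 u_int in auto)
    then have "\<forall>\<^sub>F k in sequentially. (\<integral>z. u k z \<partial>M) < true_risk M l w0 + e"
      using \<open>e > 0\<close> by (intro order_tendstoD(2)) (auto simp: true_risk_def)
    then have "\<forall>\<^sub>F k in sequentially. true_risk M l (x (k + K)) < true_risk M l w0 + e"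
    proof eventually_elim
      case (elim k)
      have "true_risk M l (x (k + K)) \<le> (\<integral>z. u k z \<partial>M)"
        unfolding true_risk_def
      proof (rule integral_mono[OF x_int u_int])
        show "l (x (k + K)) z \<le> u k z" for z
          by (simp add: u_def)
      qed
      then show ?case
        using elim by simp
    qed
    then show "\<forall>\<^sub>F k in sequentially. true_risk M l (x k) < true_risk M l w0 + e"
      by (rule eventually_sequentially_seg[THEN iffD1])
  qed
  then show ?thesis
    by (simp add: eventually_inf_principal)
qed

section \<open>Exponential tail bounds\<close>

text \<open>
  The quadratic Taylor remainder, with the square absorbed into the exponential by
  \<open>(s * \<bar>x\<bar>)\<^sup>2 / 2 \<le> exp (s * \<bar>x\<bar>)\<close>. The coefficient of \<open>\<tau>\<^sup>2\<close> does not depend on \<open>\<tau>\<close>, so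
  integration bounds the moment generating function quadratically near zero without
  differentiating it.
\<close>

lemma exp_le_quadratic_remainder:
  fixes s \<tau> x :: real
  assumes "0 < s" "\<bar>\<tau>\<bar> \<le> s"
  shows "exp (\<tau> * x) \<le> 1 + \<tau> * x + \<tau>\<^sup>2 * (exp (2 * s * \<bar>x\<bar>) / s\<^sup>2)"
proof -
  obtain t where t: "\<bar>t\<bar> \<le> \<bar>\<tau> * x\<bar>"
    and eq: "exp (\<tau> * x) = (\<Sum>k<2. (\<tau> * x) ^ k / fact k) + exp t / fact 2 * (\<tau> * x)\<^sup>2"
    using Maclaurin_exp_le by blast
  have "\<bar>\<tau> * x\<bar> \<le> s * \<bar>x\<bar>"
    using assms by (simp add: abs_mult mult_right_mono)
  with t have "exp t \<le> exp (s * \<bar>x\<bar>)"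
    by simp
  moreover have "(s * \<bar>x\<bar>)\<^sup>2 / 2 \<le> exp (s * \<bar>x\<bar>)"
    using exp_lower_Taylor_quadratic[of "s * \<bar>x\<bar>"] assms by (smt (verit) mult_nonneg_nonneg)
  ultimately have "exp t * ((s * \<bar>x\<bar>)\<^sup>2 / 2) \<le> exp (s * \<bar>x\<bar>) * exp (s * \<bar>x\<bar>)"
    by (intro mult_mono) auto
  also have "\<dots> = exp (2 * s * \<bar>x\<bar>)"
    by (simp flip: exp_add)
  finally have "exp t * x\<^sup>2 / 2 \<le> exp (2 * s * \<bar>x\<bar>) / s\<^sup>2"
    using assms(1) by (simp add: field_simps power_mult_distrib)
  then have "\<tau>\<^sup>2 * (exp t * x\<^sup>2 / 2) \<le> \<tau>\<^sup>2 * (exp (2 * s * \<bar>x\<bar>) / s\<^sup>2)"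
    by (intro mult_left_mono) auto
  then show ?thesis
    unfolding eq by (simp add: numeral_2_eq_2 power_mult_distrib mult_ac)
qed

text \<open>
  The two-sided exponential moment is at most the sum of the moments at a positive and
  at a negative \<open>\<tau>\<close>. The factor 2 matches the form of the Taylor bound.
\<close>

lemma finite_mgf_exp_abs_integrable:
  assumes [measurable]: "X \<in> borel_measurable M"
    and "\<forall>\<^sub>F \<tau> in nhds 0. mgf M X \<tau> < \<infinity>"
  obtains s where "s > 0" "integrable M (\<lambda>z. exp (2 * s * \<bar>X z\<bar>))"
proof -
  obtain d where "d > 0" and d: "\<And>\<tau>. dist \<tau> 0 < d \<Longrightarrow> mgf M X \<tau> < \<infinity>"
    using assms(2) by (auto simp: eventually_nhds_metric)
  have int: "integrable M (\<lambda>z. exp (\<tau> * X z))" if "\<bar>\<tau>\<bar> < d" for \<tau>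
    using d[of \<tau>] that by (intro integrableI_nonneg) (auto simp: mgf_def)
  have "integrable M (\<lambda>z. exp (d / 2 * X z) + exp (- (d / 2) * X z))"
    using int[of "d / 2"] int[of "- (d / 2)"] \<open>d > 0\<close> by (intro Bochner_Integration.integrable_add) auto
  then have "integrable M (\<lambda>z. exp (2 * (d / 4) * \<bar>X z\<bar>))"
  proof (rule Bochner_Integration.integrable_bound)
    have "exp (2 * (d / 4) * \<bar>x\<bar>) \<le> exp (d / 2 * x) + exp (- (d / 2) * x)" for x :: real
      by (auto simp: abs_if)
    then show "AE z in M. norm (exp (2 * (d / 4) * \<bar>X z\<bar>))
        \<le> norm (exp (d / 2 * X z) + exp (- (d / 2) * X z))"
      by (intro AE_I2) (auto intro: order_trans[OF _ abs_ge_self])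
  qed measurable
  then show ?thesis
    using that[of "d / 4"] \<open>d > 0\<close> by simp
qed

lemma exp_abs_integrable_imp_integrable:
  fixes X :: "'z \<Rightarrow> real"
  assumes [measurable]: "X \<in> borel_measurable M"
    and "s > 0" "integrable M (\<lambda>z. exp (2 * s * \<bar>X z\<bar>))"
  shows "integrable M X"
proof (rule Bochner_Integration.integrable_bound)
  show "integrable M (\<lambda>z. exp (2 * s * \<bar>X z\<bar>) / (2 * s))"
    using assms(3) by simp
  show "AE z in M. norm (X z) \<le> norm (exp (2 * s * \<bar>X z\<bar>) / (2 * s))"
  proof (rule AE_I2)
    fix z
    have "2 * s * \<bar>X z\<bar> \<le> exp (2 * s * \<bar>X z\<bar>)"
      using exp_ge_add_one_self[of "2 * s * \<bar>X z\<bar>"] by linarith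
    then show "norm (X z) \<le> norm (exp (2 * s * \<bar>X z\<bar>) / (2 * s))"
      using \<open>s > 0\<close> by (simp add: pos_le_divide_eq mult_ac)
  qed
qed measurable

lemma (in prob_space) nn_integral_exp_sum_iid:
  assumes [measurable]: "X \<in> borel_measurable M"
  shows "(\<integral>\<^sup>+ zs. ennreal (exp (\<tau> * (\<Sum>i=1..m. X (zs i)))) \<partial>(\<Pi>\<^sub>M i\<in>{1..m}. M)) = mgf M X \<tau> ^ m"
proof -
  interpret product_sigma_finite "\<lambda>_::nat. M"
    by (simp add: product_sigma_finite_def sigma_finite_measure_axioms)
  have "(\<integral>\<^sup>+ zs. ennreal (exp (\<tau> * (\<Sum>i=1..m. X (zs i)))) \<partial>(\<Pi>\<^sub>M i\<in>{1..m}. M))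
      = (\<integral>\<^sup>+ zs. (\<Prod>i\<in>{1..m}. ennreal (exp (\<tau> * X (zs i)))) \<partial>(\<Pi>\<^sub>M i\<in>{1..m}. M))"
    by (simp add: sum_distrib_left exp_sum prod_ennreal)
  also have "\<dots> = (\<Prod>i\<in>{1..m}. mgf M X \<tau>)"
    unfolding mgf_def by (rule product_nn_integral_prod) auto
  finally show ?thesis
    by simp
qed

text \<open>
  For \<open>\<tau>\<close> in \<open>{0<..s}\<close> the mean-zero condition removes the linear term, so the moment generating
  function at \<open>- \<tau>\<close> is at most \<open>1 + C * \<tau>\<^sup>2\<close>. Markov's inequality contributes
  \<open>exp (- \<tau> * \<delta>)\<close> per observation. For small \<open>\<tau>\<close> this linear gain beats the quadratic loss.
\<close>

lemma (in prob_space) chernoff_lower_tail: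
  assumes [measurable]: "X \<in> borel_measurable M"
    and mgf: "\<forall>\<^sub>F \<tau> in nhds 0. mgf M X \<tau> < \<infinity>"
    and mean: "expectation X = 0" and "\<delta> > 0"
  obtains \<beta> where "\<beta> > 0"
    "\<And>m. measure (\<Pi>\<^sub>M i\<in>{1..m}. M)
       {zs \<in> space (\<Pi>\<^sub>M i\<in>{1..m}. M). (\<Sum>i=1..m. X (zs i)) \<le> - \<delta> * real m} \<le> exp (- \<beta> * real m)"
proof -
  obtain s where "s > 0" and exp_int: "integrable M (\<lambda>z. exp (2 * s * \<bar>X z\<bar>))"
    using finite_mgf_exp_abs_integrable[OF assms(1) mgf] .
  have X_int: "integrable M X"
    using assms(1) \<open>s > 0\<close> exp_int by (rule exp_abs_integrable_imp_integrable)
  \<comment> \<open>Adding 1 makes \<open>C\<close> positive, so that one may divide by it.\<close>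
  define C where "C = expectation (\<lambda>z. exp (2 * s * \<bar>X z\<bar>) / s\<^sup>2) + 1"
  have "C > 0"
    unfolding C_def by (intro add_nonneg_pos integral_nonneg) auto
  \<comment> \<open>The quadratic loss \<open>C * \<tau>\<^sup>2\<close> is to use at most half of the gain \<open>\<tau> * \<delta>\<close>.\<close>
  define \<tau> where "\<tau> = min s (\<delta> / (2 * C))"
  have \<tau>: "0 < \<tau>" "\<tau> \<le> s" "\<tau> * C \<le> \<delta> / 2"
    using \<open>s > 0\<close> \<open>\<delta> > 0\<close> \<open>C > 0\<close> by (auto simp: \<tau>_def min_def field_simps)
  have rhs_int: "integrable M (\<lambda>z. 1 + (- \<tau>) * X z + (- \<tau>)\<^sup>2 * (exp (2 * s * \<bar>X z\<bar>) / s\<^sup>2))"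
    using X_int exp_int by (intro Bochner_Integration.integrable_add integrable_mult_right integrable_divide) auto
  have taylor: "exp ((- \<tau>) * X z) \<le> 1 + (- \<tau>) * X z + (- \<tau>)\<^sup>2 * (exp (2 * s * \<bar>X z\<bar>) / s\<^sup>2)" for z
    using \<tau> \<open>s > 0\<close> by (intro exp_le_quadratic_remainder) auto
  have "mgf M X (- \<tau>)
      \<le> (\<integral>\<^sup>+ z. ennreal (1 + (- \<tau>) * X z + (- \<tau>)\<^sup>2 * (exp (2 * s * \<bar>X z\<bar>) / s\<^sup>2)) \<partial>M)"
    unfolding mgf_def by (intro nn_integral_mono ennreal_leI taylor)
  also have "\<dots> = ennreal (expectation (\<lambda>z. 1 + (- \<tau>) * X z + (- \<tau>)\<^sup>2 * (exp (2 * s * \<bar>X z\<bar>) / s\<^sup>2)))"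
    using rhs_int taylor by (intro nn_integral_eq_integral AE_I2) (auto intro: order_trans[OF exp_ge_zero])
  also have "expectation (\<lambda>z. 1 + (- \<tau>) * X z + (- \<tau>)\<^sup>2 * (exp (2 * s * \<bar>X z\<bar>) / s\<^sup>2))
      = 1 + \<tau>\<^sup>2 * (C - 1)"
    using X_int exp_int by (simp add: C_def mean prob_space)
  also have "\<dots> \<le> 1 + \<tau> * (\<tau> * C)"
    by (simp add: power2_eq_square algebra_simps)
  also have "\<dots> \<le> 1 + \<tau> * (\<delta> / 2)"
    using \<tau> by (intro add_left_mono mult_left_mono) auto
  also have "\<dots> \<le> exp (\<tau> * \<delta> / 2)"
    using exp_ge_add_one_self[of "\<tau> * \<delta> / 2"] by simp
  finally have mgf_le: "mgf M X (- \<tau>) \<le> ennreal (exp (\<tau> * \<delta> / 2))"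
    by (simp add: ennreal_leI)
  show ?thesis
  proof (rule that)
    show "\<tau> * \<delta> / 2 > 0"
      using \<tau> \<open>\<delta> > 0\<close> by simp
    fix m :: nat
    define P where "P = (\<Pi>\<^sub>M i\<in>{1..m}. M)"
    interpret P: prob_space P
      unfolding P_def by (intro prob_space_PiM prob_space_axioms)
    have sum_meas [measurable]: "(\<lambda>zs. \<Sum>i=1..m. X (zs i)) \<in> borel_measurable P"
      unfolding P_def
      by (intro borel_measurable_sum measurable_compose[OF measurable_component_singleton[where M = "\<lambda>_. M"] assms(1)])
    define A where "A = {zs \<in> space P. (\<Sum>i=1..m. X (zs i)) \<le> - \<delta> * real m}"
    have "emeasure P A = (\<integral>\<^sup>+ zs. indicator A zs \<partial>P)"
      unfolding A_def by (intro nn_integral_indicator[symmetric]) measurable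
    also have "\<dots> \<le> (\<integral>\<^sup>+ zs. ennreal (exp (- \<tau> * \<delta> * real m))
        * ennreal (exp (- \<tau> * (\<Sum>i=1..m. X (zs i)))) \<partial>P)"
    proof (rule nn_integral_mono)
      fix zs
      show "indicator A zs \<le> ennreal (exp (- \<tau> * \<delta> * real m))
        * ennreal (exp (- \<tau> * (\<Sum>i=1..m. X (zs i))))"
      proof (cases "zs \<in> A")
        case True
        then have "\<tau> * (\<Sum>i=1..m. X (zs i)) \<le> \<tau> * (- \<delta> * real m)"
          using \<tau> by (intro mult_left_mono) (auto simp: A_def)
        then show ?thesis
          using True by (simp flip: ennreal_mult exp_add add: mult_ac)
      qed simp
    qed
    also have "\<dots> = ennreal (exp (- \<tau> * \<delta> * real m)) * mgf M X (- \<tau>) ^ m"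
      unfolding nn_integral_exp_sum_iid[OF assms(1), of m "- \<tau>", folded P_def, symmetric]
      by (intro nn_integral_cmult) measurable
    also have "\<dots> \<le> ennreal (exp (- \<tau> * \<delta> * real m)) * ennreal (exp (\<tau> * \<delta> / 2)) ^ m"
      by (intro mult_left_mono power_mono mgf_le) auto
    also have "\<dots> = ennreal (exp (- (\<tau> * \<delta> / 2) * real m))"
      by (simp add: ennreal_power algebra_simps flip: ennreal_mult exp_add exp_of_nat_mult)
    finally show "measure (\<Pi>\<^sub>M i\<in>{1..m}. M)
        {zs \<in> space (\<Pi>\<^sub>M i\<in>{1..m}. M). (\<Sum>i=1..m. X (zs i)) \<le> - \<delta> * real m}
        \<le> exp (- (\<tau> * \<delta> / 2) * real m)"
      unfolding P_def[symmetric] A_def[symmetric] by (simp add: P.emeasure_eq_measure)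
  qed
qed

text \<open>
  Integrability of the loss, which gives its deviation from the true risk mean zero, itself follows
  from the exponential moments.
\<close>

lemma (in prob_space) empirical_risk_lower_tail:
  assumes meas: "l w \<in> borel_measurable M"
    and mgf: "\<forall>\<^sub>F \<tau> in nhds 0. mgf M (\<lambda>z. l w z - true_risk M l w) \<tau> < \<infinity>"
    and "\<delta> > 0"
  shows "integrable M (l w)"
    and "\<exists>\<beta>>0. \<forall>m\<ge>1. measure (\<Pi>\<^sub>M i\<in>{1..m}. M)
       {zs \<in> space (\<Pi>\<^sub>M i\<in>{1..m}. M). empirical_risk l m zs w \<le> true_risk M l w - \<delta>} \<le> exp (- \<beta> * real m)"
proof -
  define X where "X z = l w z - true_risk M l w" for z
  have X_meas: "X \<in> borel_measurable M"
    using meas by (simp add: X_def[abs_def])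
  have X_mgf: "\<forall>\<^sub>F \<tau> in nhds 0. mgf M X \<tau> < \<infinity>"
    using mgf by (simp add: X_def[abs_def])
  obtain s where "s > 0" and exp_int: "integrable M (\<lambda>z. exp (2 * s * \<bar>X z\<bar>))"
    using finite_mgf_exp_abs_integrable[OF X_meas X_mgf] .
  have "integrable M (\<lambda>z. X z + true_risk M l w)"
    using exp_abs_integrable_imp_integrable[OF X_meas \<open>s > 0\<close> exp_int] by simp
  then show int: "integrable M (l w)"
    by (simp add: X_def)
  have mean: "expectation X = 0"
    using int by (simp add: X_def[abs_def] true_risk_def prob_space)
  obtain \<beta> where "\<beta> > 0" and \<beta>: "\<And>m. measure (\<Pi>\<^sub>M i\<in>{1..m}. M)
       {zs \<in> space (\<Pi>\<^sub>M i\<in>{1..m}. M). (\<Sum>i=1..m. X (zs i)) \<le> - \<delta> * real m} \<le> exp (- \<beta> * real m)"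
    using chernoff_lower_tail[OF X_meas X_mgf mean \<open>\<delta> > 0\<close>] by blast
  have "empirical_risk l m zs w \<le> true_risk M l w - \<delta> \<longleftrightarrow> (\<Sum>i=1..m. X (zs i)) \<le> - \<delta> * real m"
    if "m \<ge> 1" for m zs
    using that by (simp add: empirical_risk_def X_def sum_subtractf field_simps)
  then show "\<exists>\<beta>>0. \<forall>m\<ge>1. measure (\<Pi>\<^sub>M i\<in>{1..m}. M)
       {zs \<in> space (\<Pi>\<^sub>M i\<in>{1..m}. M). empirical_risk l m zs w \<le> true_risk M l w - \<delta>} \<le> exp (- \<beta> * real m)"
    using \<open>\<beta> > 0\<close> \<beta> by auto
qed

section \<open>The uniform bound\<close>

text \<open>
  Around each point of \<open>W\<close>, upper semicontinuity of the risk and continuity of the norm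
  give an open set on which both conditions hold; compactness leaves finitely many.
\<close>

lemma finite_cover_of_risk:
  fixes l :: "'w::euclidean_space \<Rightarrow> 'z \<Rightarrow> real"
  assumes "is_norm N" "compact W" "caratheodory M l" "locally_sup_integrable N M l"
    and int: "\<And>w. w \<in> W \<Longrightarrow> integrable M (l w)"
    and "\<delta> > 0" "\<gamma> > 0"
  obtains F where "finite F" "F \<subseteq> W"
    "\<And>w. w \<in> W \<Longrightarrow> \<exists>c\<in>F. N (c - w) \<le> \<gamma> \<and> true_risk M l w < true_risk M l c + \<delta>"
proof -
  have "\<exists>U. open U \<and> c \<in> U \<and>
      (\<forall>w\<in>U. w \<in> W \<longrightarrow> N (c - w) \<le> \<gamma> \<and> true_risk M l w < true_risk M l c + \<delta>)" if "c \<in> W" for c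
  proof -
    have "\<forall>\<^sub>F w in nhds c. integrable M (l w) \<longrightarrow> true_risk M l w < true_risk M l c + \<delta>"
      using assms that by (intro true_risk_upper_semicontinuous) auto
    moreover have "\<forall>\<^sub>F w in nhds c. N (c - w) < \<gamma>"
    proof (rule order_tendstoD(2))
      have "((\<lambda>w. c - w) \<longlongrightarrow> c - c) (nhds c)"
        by (intro tendsto_diff tendsto_const filterlim_ident)
      then show "((\<lambda>w. N (c - w)) \<longlongrightarrow> N (c - c)) (nhds c)"
        by (rule continuous_on_tendsto_compose[OF is_norm_continuous_on[OF assms(1)]]) auto
    qed (use assms in \<open>simp add: is_norm_zero\<close>)
    ultimately have "\<forall>\<^sub>F w in nhds c. w \<in> W \<longrightarrow>
        N (c - w) \<le> \<gamma> \<and> true_risk M l w < true_risk M l c + \<delta>"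
      by eventually_elim (use int in auto)
    then show ?thesis
      by (auto simp: eventually_nhds)
  qed
  then obtain U where U: "\<And>c. c \<in> W \<Longrightarrow> open (U c)" "\<And>c. c \<in> W \<Longrightarrow> c \<in> U c"
    "\<And>c w. c \<in> W \<Longrightarrow> w \<in> U c \<Longrightarrow> w \<in> W \<Longrightarrow>
       N (c - w) \<le> \<gamma> \<and> true_risk M l w < true_risk M l c + \<delta>"
    by metis
  obtain F where "F \<subseteq> W" "finite F" "W \<subseteq> (\<Union>c\<in>F. U c)"
    using compactE_image[OF assms(2), of W U] U(1,2) by blast
  then show ?thesis
    using that[of F] U(3) by blast
qed

theorem theorem3p2:
  fixes M :: "(real ^ 'd) measure"
    and N :: "real ^ 'n \<Rightarrow> real"
    and W :: "(real ^ 'n) set"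
    and l :: "real ^ 'n \<Rightarrow> real ^ 'd \<Rightarrow> real"
    and \<epsilon> \<gamma> :: real
  assumes "prob_space M"
    and "is_norm N"
    and "compact W"
    and "caratheodory M l"
    and "locally_sup_integrable N M l"
    and "\<And>w. w \<in> W \<Longrightarrow> \<forall>\<^sub>F \<tau> in nhds 0. mgf M (\<lambda>z. l w z - true_risk M l w) \<tau> < \<infinity>"
    and "\<epsilon> > 0"
    and "\<gamma> > 0"
  shows "\<exists>\<eta>>0. \<exists>\<beta>>0. \<forall>m\<ge>1.
           measure (\<Pi>\<^sub>M i\<in>{1..m}. M)
             {zs \<in> space (\<Pi>\<^sub>M i\<in>{1..m}. M).
                (SUP w\<in>W. ereal (true_risk M l w) - diametrical_risk N l \<gamma> m zs w) \<le> ereal \<epsilon>}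
           \<ge> 1 - \<eta> * exp (- \<beta> * real m)"
proof -
  interpret prob_space M by fact
  let ?R = "true_risk M l"
  have meas: "l w \<in> borel_measurable M" for w
    using assms(4) by (auto simp: caratheodory_def)
  have "\<epsilon> / 2 > 0"
    using \<open>\<epsilon> > 0\<close> by simp
  note tail = empirical_risk_lower_tail[OF meas assms(6) \<open>\<epsilon> / 2 > 0\<close>]
  obtain F where F: "finite F" "F \<subseteq> W"
    and cover: "\<And>w. w \<in> W \<Longrightarrow> \<exists>c\<in>F. N (c - w) \<le> \<gamma> \<and> ?R w < ?R c + \<epsilon> / 2"
    using finite_cover_of_risk[OF assms(2-5) tail(1) \<open>\<epsilon> / 2 > 0\<close> assms(8)] by blast
  define bad where "bad m c = {zs \<in> space (\<Pi>\<^sub>M i\<in>{1..m}. M). empirical_risk l m zs c \<le> ?R c - \<epsilon> / 2}"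
    for m :: nat and c
  have "\<forall>c\<in>F. \<exists>\<beta>>0. \<forall>m\<ge>1. measure (\<Pi>\<^sub>M i\<in>{1..m}. M) (bad m c) \<le> exp (- \<beta> * real m)"
    using tail(2) F(2) unfolding bad_def by blast
  then obtain b where b: "\<And>c. c \<in> F \<Longrightarrow> b c > 0"
    "\<And>c m. c \<in> F \<Longrightarrow> m \<ge> 1 \<Longrightarrow> measure (\<Pi>\<^sub>M i\<in>{1..m}. M) (bad m c) \<le> exp (- b c * real m)"
    by (auto dest!: bchoice)
  \<comment> \<open>The element 1 keeps the minimum meaningful when \<open>W\<close>, and hence \<open>F\<close>, is empty; likewise the summand 1 keeps \<open>\<eta>\<close> positive.\<close>
  define \<beta> where "\<beta> = Min (insert 1 (b ` F))"
  have "\<beta> > 0"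
    using F(1) b(1) by (auto simp: \<beta>_def)
  have \<beta>_le: "\<beta> \<le> b c" if "c \<in> F" for c
    using F(1) that by (auto simp: \<beta>_def)
  have "1 - (real (card F) + 1) * exp (- \<beta> * real m) \<le> measure (\<Pi>\<^sub>M i\<in>{1..m}. M)
      {zs \<in> space (\<Pi>\<^sub>M i\<in>{1..m}. M). (SUP w\<in>W. ereal (?R w) - diametrical_risk N l \<gamma> m zs w) \<le> ereal \<epsilon>}"
    if "m \<ge> 1" for m
  proof -
    define P where "P = (\<Pi>\<^sub>M i\<in>{1..m}. M)"
    interpret P: prob_space P
      unfolding P_def by (intro prob_space_PiM prob_space_axioms)
    define E where "E = {zs \<in> space P. (SUP w\<in>W. ereal (?R w) - diametrical_risk N l \<gamma> m zs w) \<le> ereal \<epsilon>}"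
    have E_sets: "E \<in> sets P"
      unfolding E_def P_def using assms(2,4,8) by (intro deviation_event_measurable) auto
    have bad_sets: "bad m c \<in> sets P" for c
      unfolding bad_def P_def using empirical_risk_measurable[OF meas] by measurable
    have "space P - E \<subseteq> (\<Union>c\<in>F. bad m c)"
    proof (rule subsetI, rule ccontr)
      fix zs assume zs: "zs \<in> space P - E" "zs \<notin> (\<Union>c\<in>F. bad m c)"
      have "ereal (?R w) - diametrical_risk N l \<gamma> m zs w \<le> ereal \<epsilon>" if w: "w \<in> W" for w
      proof -
        obtain c where c: "c \<in> F" "N (c - w) \<le> \<gamma>" "?R w < ?R c + \<epsilon> / 2"
          using cover[OF w] by blast
        have "?R c - \<epsilon> / 2 < empirical_risk l m zs c"
          using zs c(1) by (force simp: bad_def P_def)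
        then have "?R w - \<epsilon> \<le> empirical_risk l m zs c"
          using c(3) by simp
        have "ereal (empirical_risk l m zs (w + (c - w))) \<le> diametrical_risk N l \<gamma> m zs w"
          unfolding diametrical_risk_def using c(2) by (intro SUP_upper) simp
        then have "ereal (?R w) - diametrical_risk N l \<gamma> m zs w
            \<le> ereal (?R w) - ereal (empirical_risk l m zs c)"
          by (intro ereal_minus_mono) auto
        also have "\<dots> \<le> ereal \<epsilon>"
          using \<open>?R w - \<epsilon> \<le> empirical_risk l m zs c\<close> by simp
        finally show ?thesis .
      qed
      then have "zs \<in> E"
        using zs(1) by (auto simp: E_def SUP_le_iff)
      then show False
        using zs(1) by simp
    qed
    then have "P.prob (space P - E) \<le> P.prob (\<Union>c\<in>F. bad m c)"
      using bad_sets F(1) by (intro P.finite_measure_mono) auto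
    also have "\<dots> \<le> (\<Sum>c\<in>F. P.prob (bad m c))"
      using bad_sets F(1) by (intro P.finite_measure_subadditive_finite) auto
    also have "\<dots> \<le> (\<Sum>c\<in>F. exp (- \<beta> * real m))"
    proof (rule sum_mono)
      fix c assume "c \<in> F"
      then have "P.prob (bad m c) \<le> exp (- b c * real m)"
        unfolding P_def using b(2) \<open>m \<ge> 1\<close> by blast
      also have "\<dots> \<le> exp (- \<beta> * real m)"
        using \<beta>_le[OF \<open>c \<in> F\<close>] by (simp add: mult_right_mono)
      finally show "P.prob (bad m c) \<le> exp (- \<beta> * real m)" .
    qed
    also have "\<dots> \<le> (real (card F) + 1) * exp (- \<beta> * real m)"
      by (simp add: algebra_simps)
    finally show ?thesis
      using P.prob_compl[OF E_sets] unfolding E_def P_def by simp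
  qed
  then show ?thesis
    using \<open>\<beta> > 0\<close> by (intro exI[of _ "real (card F) + 1"] exI[of _ \<beta>] conjI allI impI) auto
qed

end
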